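(* Let $k\ge 3$ be an integer. Let $\mathcal{R}_{k}$ be the undirected graph whose vertices are all hereditarily finite sets $S$ that contain no complete subset with $k-1$ elements, and in which two vertices $S\neq S'$ are adjacent if and only if $S\in S'$ or $S'\in S$. Then $\mathcal{R}_{k}$ does not contain the complete graph $K_k$ as a subgraph, and $\mathcal{R}_{k}$ is the generic graph for the class of all countable graphs not containing $K_k$: that is, $\mathcal{R}_k$ is ultrahomogeneous and every countable $K_k$-free graph is isomorphic to an induced subgraph of $\mathcal{R}_k$.
   Context: A finite set $S$ is called complete if for any $X,Y\in S$ with $X\neq Y$, either $X\in Y$ or $Y\in X$. Sets are taken in a fixed countable model of the theory of hereditarily finite sets (no atoms). A structure is ultrahomogeneous if every isomorphism between two finite induced substructures extends to an automorphism of the whole structure. *)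

theory Defs
  imports Complex_Main "HOL-Library.FSet" "HOL-Library.Countable_Set" "HOL-Library.Nat_Bijection"
begin

text \<open>
  The standard model of the theory of hereditarily finite sets without atoms: the least fixed
  point of the finite powerset operator, i.e. \<open>V\<^sub>\<omega>\<close>. Since the constructor acts on finite sets,
  \<open>hset.inject\<close> is extensionality and \<open>hset.induct\<close> is induction along membership.
\<close>

datatype hset = HSet (elts: "hset fset")

definition hmem :: "hset \<Rightarrow> hset \<Rightarrow> bool" (infix "\<epsilon>" 50) where
  "X \<epsilon> S \<longleftrightarrow> X |\<in>| elts S"

definition hsubset :: "hset \<Rightarrow> hset \<Rightarrow> bool" where
  "hsubset T S \<longleftrightarrow> (\<forall>X. X \<epsilon> T \<longrightarrow> X \<epsilon> S)"

definition hcard :: "hset \<Rightarrow> nat" where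
  "hcard S = card {X. X \<epsilon> S}"

definition complete_hset :: "hset \<Rightarrow> bool" where
  "complete_hset S \<longleftrightarrow> (\<forall>X Y. X \<epsilon> S \<longrightarrow> Y \<epsilon> S \<longrightarrow> X \<noteq> Y \<longrightarrow> X \<epsilon> Y \<or> Y \<epsilon> X)"

lemma hset_extensionality: "S = T \<longleftrightarrow> (\<forall>X. X \<epsilon> S \<longleftrightarrow> X \<epsilon> T)"
  by (metis hmem_def fset_eqI hset.expand)

lemma hset_of_finite_set: "finite A \<Longrightarrow> \<exists>!S. \<forall>X. X \<epsilon> S \<longleftrightarrow> X \<in> A"
proof -
  assume "finite A"
  then have "\<forall>X. X \<epsilon> HSet (Abs_fset A) \<longleftrightarrow> X \<in> A"
    by (simp add: hmem_def Abs_fset_inverse)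
  then show ?thesis by (metis hset_extensionality)
qed

lemma hset_finite: "finite {X. X \<epsilon> S}"
  by (simp add: hmem_def)

lemma hset_mem_induct:
  assumes "\<And>S. (\<And>X. X \<epsilon> S \<Longrightarrow> P X) \<Longrightarrow> P S"
  shows "P S"
proof (induction S)
  case (HSet A)
  show ?case by (rule assms) (use HSet in \<open>simp add: hmem_def\<close>)
qed

text \<open>Ackermann's coding, which shows that the model is countable.\<close>

primrec hcode :: "hset \<Rightarrow> nat" where
  "hcode (HSet A) = set_encode (fset (fimage hcode A))"

lemma hcode_inject: "hcode S = hcode T \<Longrightarrow> S = T"
proof (induction S arbitrary: T)
  case (HSet A)
  obtain B where T: "T = HSet B" by (cases T)
  have eq: "hcode ` fset A = hcode ` fset B"
    using HSet.prems by (simp add: T set_encode_eq)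
  have "fset A = fset B"
  proof (intro set_eqI iffI)
    fix X assume X: "X \<in> fset A"
    then obtain Y where "Y \<in> fset B" "hcode X = hcode Y"
      using eq by (metis imageE imageI)
    with HSet.IH X show "X \<in> fset B" by metis
  next
    fix Y assume "Y \<in> fset B"
    then obtain X where "X \<in> fset A" "hcode X = hcode Y"
      using eq by (metis imageE imageI)
    with HSet.IH show "Y \<in> fset A" by metis
  qed
  then show ?case by (simp add: T fset_inject)
qed

instance hset :: countable
  by (rule countable_classI[of hcode]) (rule hcode_inject)

record 'a ugraph =
  verts :: "'a set"
  adj :: "'a \<Rightarrow> 'a \<Rightarrow> bool"

definition is_ugraph :: "'a ugraph \<Rightarrow> bool" where
  "is_ugraph G \<longleftrightarrow>
     (\<forall>x y. adj G x y \<longrightarrow> x \<in> verts G \<and> y \<in> verts G) \<and>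
     (\<forall>x. \<not> adj G x x) \<and>
     (\<forall>x y. adj G x y \<longrightarrow> adj G y x)"

definition subgraph :: "'a ugraph \<Rightarrow> 'a ugraph \<Rightarrow> bool" where
  "subgraph H G \<longleftrightarrow>
     is_ugraph H \<and> verts H \<subseteq> verts G \<and> (\<forall>x y. adj H x y \<longrightarrow> adj G x y)"

definition induced :: "'a ugraph \<Rightarrow> 'a set \<Rightarrow> 'a ugraph" where
  "induced G W = \<lparr>verts = verts G \<inter> W, adj = \<lambda>x y. x \<in> W \<and> y \<in> W \<and> adj G x y\<rparr>"

definition graph_iso :: "('a \<Rightarrow> 'b) \<Rightarrow> 'a ugraph \<Rightarrow> 'b ugraph \<Rightarrow> bool" where
  "graph_iso f G H \<longleftrightarrow>
     bij_betw f (verts G) (verts H) \<and>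
     (\<forall>x \<in> verts G. \<forall>y \<in> verts G. adj G x y \<longleftrightarrow> adj H (f x) (f y))"

definition isomorphic :: "'a ugraph \<Rightarrow> 'b ugraph \<Rightarrow> bool" where
  "isomorphic G H \<longleftrightarrow> (\<exists>f. graph_iso f G H)"

definition contains_subgraph :: "'a ugraph \<Rightarrow> 'b ugraph \<Rightarrow> bool" where
  "contains_subgraph G F \<longleftrightarrow> (\<exists>H. subgraph H G \<and> isomorphic F H)"

definition complete_graph :: "nat \<Rightarrow> nat ugraph" where
  "complete_graph n = \<lparr>verts = {..<n}, adj = \<lambda>i j. i < n \<and> j < n \<and> i \<noteq> j\<rparr>"

text \<open>Countable includes finite (and empty), as usual for universality statements.\<close>

definition countable_K_free :: "nat \<Rightarrow> 'a ugraph set" where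
  "countable_K_free k =
     {G. is_ugraph G \<and> countable (verts G) \<and> \<not> contains_subgraph G (complete_graph k)}"

definition ultrahomogeneous :: "'a ugraph \<Rightarrow> bool" where
  "ultrahomogeneous G \<longleftrightarrow>
     (\<forall>A B f. finite A \<longrightarrow> A \<subseteq> verts G \<longrightarrow> finite B \<longrightarrow> B \<subseteq> verts G \<longrightarrow>
        graph_iso f (induced G A) (induced G B) \<longrightarrow>
        (\<exists>g. graph_iso g G G \<and> (\<forall>x \<in> A. g x = f x)))"

definition generic_for :: "'b ugraph set \<Rightarrow> 'a ugraph \<Rightarrow> bool" where
  "generic_for C R \<longleftrightarrow>
     ultrahomogeneous R \<and> (\<forall>G \<in> C. \<exists>W \<subseteq> verts R. isomorphic G (induced R W))"

definition R_graph :: "nat \<Rightarrow> hset ugraph" where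
  "R_graph k =
     (let V = {S. \<not> (\<exists>T. hsubset T S \<and> complete_hset T \<and> hcard T = k - 1)}
      in \<lparr>verts = V, adj = \<lambda>S S'. S \<in> V \<and> S' \<in> V \<and> S \<noteq> S' \<and> (S \<epsilon> S' \<or> S' \<epsilon> S)\<rparr>)"

lemma is_ugraph_R_graph: "is_ugraph (R_graph k)"
  by (auto simp: is_ugraph_def R_graph_def Let_def)

end

theory Submission
  imports Defs
begin

text \<open>
  Membership is well-founded, so a clique of \<open>\<R>\<^sub>k\<close> is linearly ordered by membership; the largest
  vertex of a \<open>k\<close>-clique would contain the other \<open>k - 1\<close> vertices, a complete subset.
  Conversely, let \<open>A\<close> and \<open>B\<close> be disjoint finite sets of vertices such that \<open>A\<close> has no
  \<open>(k-1)\<close>-clique. Then \<open>A \<union> {w}\<close>, for a singleton \<open>w\<close> unrelated to all sets in sight, is a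
  vertex adjacent to everything in \<open>A\<close> and to nothing in \<open>B\<close>: the element \<open>w\<close> is in no complete
  subset with two elements and serves to keep \<open>A \<union> {w}\<close> out of \<open>A\<close>, of \<open>B\<close> and of the elements
  of \<open>B\<close>. This extension property yields universality by going forth, and ultrahomogeneity by
  going back and forth.
\<close>

section \<open>Cliques\<close>

definition clique :: "'a ugraph \<Rightarrow> 'a set \<Rightarrow> bool" where
  "clique G K \<longleftrightarrow> K \<subseteq> verts G \<and> (\<forall>x\<in>K. \<forall>y\<in>K. x \<noteq> y \<longrightarrow> adj G x y)"

definition clique_free :: "nat \<Rightarrow> 'a ugraph \<Rightarrow> bool" where
  "clique_free k G \<longleftrightarrow> \<not> (\<exists>K. finite K \<and> card K = k \<and> clique G K)"

text \<open>The vertex set of a copy of the complete graph is a clique; conversely, any enumeration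
  of a \<open>k\<close>-clique by \<open>{..<k}\<close> is an isomorphism onto the subgraph it
  induces. Later arguments can thus speak of sets of vertices only.\<close>

lemma contains_complete_graph_iff:
  assumes G: "is_ugraph G"
  shows "contains_subgraph G (complete_graph k) \<longleftrightarrow> \<not> clique_free k G"
proof
  assume "contains_subgraph G (complete_graph k)"
  then obtain H f where H: "subgraph H G" and f: "graph_iso f (complete_graph k) H"
    by (auto simp: contains_subgraph_def isomorphic_def)
  have bij: "bij_betw f {..<k} (verts H)"
    and adj: "\<And>i j. i < k \<Longrightarrow> j < k \<Longrightarrow> i \<noteq> j \<Longrightarrow> adj H (f i) (f j)"
    using f by (auto simp: graph_iso_def complete_graph_def)
  have img: "verts H = f ` {..<k}"
    using bij by (simp add: bij_betw_def)
  have "clique G (verts H)"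
    unfolding clique_def
  proof (intro conjI ballI impI)
    show "verts H \<subseteq> verts G"
      using H by (simp add: subgraph_def)
    fix x y assume "x \<in> verts H" "y \<in> verts H" "x \<noteq> y"
    then have "adj H x y"
      unfolding img using adj by auto
    then show "adj G x y"
      using H by (simp add: subgraph_def)
  qed
  moreover have "card (verts H) = k"
    using bij_betw_same_card[OF bij] by simp
  moreover have "finite (verts H)"
    by (simp add: img)
  ultimately show "\<not> clique_free k G"
    by (auto simp: clique_free_def)
next
  assume "\<not> clique_free k G"
  then obtain K where K: "finite K" "card K = k" "clique G K"
    by (auto simp: clique_free_def)
  obtain f where f: "bij_betw f {..<k} K"
    using K ex_bij_betw_nat_finite[of K] by (auto simp: atLeast0LessThan)
  have sub: "subgraph (induced G K) G"
    using G by (auto simp: subgraph_def induced_def is_ugraph_def)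
  have verts: "verts (induced G K) = K"
    using K by (auto simp: induced_def clique_def)
  have "graph_iso f (complete_graph k) (induced G K)"
    unfolding graph_iso_def verts
  proof (intro conjI ballI)
    show "bij_betw f (verts (complete_graph k)) K"
      using f by (simp add: complete_graph_def)
    fix i j assume "i \<in> verts (complete_graph k)" "j \<in> verts (complete_graph k)"
    then have ij: "i < k" "j < k"
      by (auto simp: complete_graph_def)
    then have "f i \<in> K" "f j \<in> K" "f i = f j \<longleftrightarrow> i = j"
      using f by (auto simp: bij_betw_def inj_on_def)
    then show "adj (complete_graph k) i j \<longleftrightarrow> adj (induced G K) (f i) (f j)"
      using K G ij by (auto simp: complete_graph_def induced_def clique_def is_ugraph_def)
  qed
  with sub show "contains_subgraph G (complete_graph k)"
    by (auto simp: contains_subgraph_def isomorphic_def)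
qed

section \<open>Partial isomorphisms and the extension property\<close>

text \<open>A relation is used instead of a function with a domain: going back is then going forth
  for the converse, and limits are plain unions. The equivalence of the two equalities says at once
  that \<open>P\<close> is single-valued and injective.\<close>

definition partial_iso :: "'a ugraph \<Rightarrow> 'b ugraph \<Rightarrow> ('a \<times> 'b) set \<Rightarrow> bool" where
  "partial_iso G H P \<longleftrightarrow> P \<subseteq> verts G \<times> verts H \<and>
     (\<forall>a b a' b'. (a, b) \<in> P \<longrightarrow> (a', b') \<in> P \<longrightarrow>
        (a = a' \<longleftrightarrow> b = b') \<and> (adj G a a' \<longleftrightarrow> adj H b b'))"

text \<open>The one-point extension axiom of Henson's universal homogeneous graph without
  \<open>k\<close>-cliques. A \<open>(k - 1)\<close>-clique in \<open>A\<close> is excluded because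
  \<open>z\<close> would complete it to a \<open>k\<close>-clique. In a graph, adjacency to all of
  \<open>A\<close> keeps \<open>z\<close> out of \<open>A\<close>, whereas staying out of
  \<open>B\<close> has to be demanded.\<close>

definition extension_property :: "nat \<Rightarrow> 'a ugraph \<Rightarrow> bool" where
  "extension_property k H \<longleftrightarrow>
     (\<forall>A B. finite A \<longrightarrow> finite B \<longrightarrow> A \<subseteq> verts H \<longrightarrow> B \<subseteq> verts H \<longrightarrow> A \<inter> B = {} \<longrightarrow>
        \<not> (\<exists>K\<subseteq>A. clique H K \<and> card K = k - 1) \<longrightarrow>
        (\<exists>z\<in>verts H. z \<notin> B \<and> (\<forall>a\<in>A. adj H z a) \<and> (\<forall>b\<in>B. \<not> adj H z b)))"

lemma partial_isoD:
  assumes "partial_iso G H P" "(a, b) \<in> P" "(a', b') \<in> P"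
  shows "a = a' \<longleftrightarrow> b = b'" "adj G a a' \<longleftrightarrow> adj H b b'"
  using assms unfolding partial_iso_def by blast+

lemma partial_iso_converse: "partial_iso H G (P\<inverse>) \<longleftrightarrow> partial_iso G H P"
proof -
  \<comment> \<open>One implication with fresh types, so that it can be instantiated at
    \<open>P\<close> and, with the graphs swapped, at the converse of \<open>P\<close>.\<close>
  have "partial_iso H' G' (R\<inverse>)" if "partial_iso G' H' R"
    for G' :: "'c ugraph" and H' :: "'d ugraph" and R
    unfolding partial_iso_def
  proof (intro conjI allI impI)
    show "R\<inverse> \<subseteq> verts H' \<times> verts G'"
      using that by (auto simp: partial_iso_def)
  qed (use partial_isoD[OF that] in auto)
  from this[of G H P] this[of H G "P\<inverse>"] show ?thesis by auto
qed

text \<open>The defining condition compares two pairs at a time, and any two pairs of the union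
  already lie in one member of the chain.\<close>

lemma partial_iso_UN_chain:
  assumes "\<And>n :: nat. partial_iso G H (P n)" "mono P"
  shows "partial_iso G H (\<Union>n. P n)"
  unfolding partial_iso_def
proof (intro conjI allI impI)
  show "(\<Union>n. P n) \<subseteq> verts G \<times> verts H"
    using assms(1) by (auto simp: partial_iso_def)
  fix a b a' b' assume "(a, b) \<in> (\<Union>n. P n)" "(a', b') \<in> (\<Union>n. P n)"
  then obtain m n where "(a, b) \<in> P m" "(a', b') \<in> P n"
    by auto
  then have "(a, b) \<in> P (max m n)" "(a', b') \<in> P (max m n)"
    using monoD[OF assms(2)] by (meson max.cobounded1 max.cobounded2 subsetD)+
  then show "a = a' \<longleftrightarrow> b = b'" "adj G a a' \<longleftrightarrow> adj H b b'"
    using assms(1)[of "max m n"] unfolding partial_iso_def by blast+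
qed

lemma partial_iso_graph_iso:
  assumes P: "partial_iso G H P" and dom: "Domain P = verts G"
  shows "\<exists>f. graph_iso f G (induced H (Range P)) \<and> (\<forall>x y. (x, y) \<in> P \<longrightarrow> f x = y)"
proof -
  have "\<forall>x\<in>verts G. \<exists>y. (x, y) \<in> P"
    using dom by blast
  then obtain f where f: "\<And>x. x \<in> verts G \<Longrightarrow> (x, f x) \<in> P"
    by metis
  have eq: "f x = y" if "(x, y) \<in> P" for x y
    using partial_isoD(1)[OF P _ that] f dom that by blast
  have verts: "verts (induced H (Range P)) = Range P"
    using P by (auto simp: induced_def partial_iso_def)
  have "graph_iso f G (induced H (Range P))"
    unfolding graph_iso_def verts bij_betw_def
  proof (intro conjI ballI)
    show "inj_on f (verts G)"
      using P f unfolding partial_iso_def inj_on_def by metis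
    show "f ` verts G = Range P"
      using f eq dom by (auto simp: image_iff) force
    fix x y assume "x \<in> verts G" "y \<in> verts G"
    then have "(x, f x) \<in> P" "(y, f y) \<in> P"
      using f by auto
    then show "adj G x y \<longleftrightarrow> adj (induced H (Range P)) (f x) (f y)"
      using P unfolding partial_iso_def induced_def by auto
  qed
  with eq show ?thesis by blast
qed

text \<open>The forth step. The image of \<open>y\<close> must be joined to the images of the
  neighbours of \<open>x\<close> and to no other vertex in the range; a
  \<open>(k - 1)\<close>-clique among the former would pull back along \<open>P\<close> to a clique
  of \<open>G\<close> which \<open>x\<close> enlarges to size \<open>k\<close>.\<close>

lemma partial_iso_extend:
  assumes G: "is_ugraph G" "clique_free k G" and H: "is_ugraph H" "extension_property k H"
    and k: "k \<ge> 2" and P: "finite P" "partial_iso G H P" and x: "x \<in> verts G"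
  shows "\<exists>y. partial_iso G H (insert (x, y) P)"
proof (cases "x \<in> Domain P")
  case True
  then show ?thesis
    using P(2) by (metis DomainE insert_absorb)
next
  case False
  define A where "A = P `` {a. adj G x a}"
  define B where "B = P `` {a. \<not> adj G x a}"
  have ABP: "finite A" "finite B" "A \<subseteq> verts H" "B \<subseteq> verts H" "A \<inter> B = {}"
    using P partial_isoD(1)[OF P(2)] by (auto simp: A_def B_def partial_iso_def)
  have "\<not> (\<exists>K\<subseteq>A. clique H K \<and> card K = k - 1)"
  proof
    assume "\<exists>K\<subseteq>A. clique H K \<and> card K = k - 1"
    then obtain K where K: "K \<subseteq> A" "clique H K" "card K = k - 1"
      by auto
    have "\<forall>b\<in>K. \<exists>a. (a, b) \<in> P \<and> adj G x a"
      using K(1) by (auto simp: A_def)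
    \<comment> \<open>\<open>g\<close> picks preimages under \<open>P\<close>; it carries the clique
      \<open>K\<close> of \<open>H\<close> back into the neighbourhood of \<open>x\<close>.\<close>
    then obtain g where g: "\<And>b. b \<in> K \<Longrightarrow> (g b, b) \<in> P \<and> adj G x (g b)"
      by metis
    have inj: "inj_on g K"
      using P(2) g unfolding partial_iso_def inj_on_def by metis
    have fin: "finite K"
      using K(1) ABP(1) finite_subset by blast
    have "x \<notin> g ` K"
      using g False by blast
    then have "card (insert x (g ` K)) = k"
      using k fin K(3) by (simp add: card_image[OF inj])
    moreover have "clique G (insert x (g ` K))"
      unfolding clique_def
    proof (intro conjI ballI impI)
      show "insert x (g ` K) \<subseteq> verts G"
        using x g P(2) by (auto simp: partial_iso_def)
      have adj: "adj G (g b) (g c)" if "b \<in> K" "c \<in> K" "g b \<noteq> g c" for b c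
      proof -
        have "adj H b c"
          using K(2) that unfolding clique_def by auto
        then show ?thesis
          using P(2) g that unfolding partial_iso_def by blast
      qed
      have "adj G x (g b)" "adj G (g b) x" if "b \<in> K" for b
        using g[OF that] G(1) by (simp_all add: is_ugraph_def)
      moreover fix u v assume "u \<in> insert x (g ` K)" "v \<in> insert x (g ` K)" "u \<noteq> v"
      ultimately show "adj G u v"
        using adj by auto
    qed
    ultimately show False
      using G(2) fin by (auto simp: clique_free_def)
  qed
  then obtain z where z: "z \<in> verts H" "z \<notin> B" "\<forall>a\<in>A. adj H z a" "\<forall>b\<in>B. \<not> adj H z b"
    using H(2)[unfolded extension_property_def, rule_format, OF ABP] by blast
  have irr: "\<not> adj G u u" "\<not> adj H v v" and sym: "adj G u w \<longleftrightarrow> adj G w u" "adj H v t \<longleftrightarrow> adj H t v"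
    for u w v t
    using G(1) H(1) unfolding is_ugraph_def by blast+
  \<comment> \<open>That \<open>z\<close> is a new value has two sources: irreflexivity for
    \<open>b\<close> in \<open>A\<close>, and the clause \<open>z \<notin> B\<close> for
    \<open>b\<close> in \<open>B\<close>.\<close>
  have new: "a \<noteq> x \<and> b \<noteq> z \<and> (adj G x a \<longleftrightarrow> adj H z b)" if "(a, b) \<in> P" for a b
  proof (cases "adj G x a")
    case True
    then have "b \<in> A" using that by (auto simp: A_def)
    then show ?thesis using z irr True by metis
  next
    case nadj: False
    then have "b \<in> B" using that by (auto simp: B_def)
    then show ?thesis using z nadj that False by blast
  qed
  have "partial_iso G H (insert (x, z) P)"
    unfolding partial_iso_def
  proof (intro conjI allI impI)
    show "insert (x, z) P \<subseteq> verts G \<times> verts H"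
      using P(2) x z by (auto simp: partial_iso_def)
    fix a b a' b'
    assume "(a, b) \<in> insert (x, z) P" "(a', b') \<in> insert (x, z) P"
    then consider "a = x" "b = z" "a' = x" "b' = z" | "a = x" "b = z" "(a', b') \<in> P"
      | "(a, b) \<in> P" "a' = x" "b' = z" | "(a, b) \<in> P" "(a', b') \<in> P"
      by blast
    then have "(a = a' \<longleftrightarrow> b = b') \<and> (adj G a a' \<longleftrightarrow> adj H b b')"
    proof cases
      case 1 then show ?thesis using irr by simp
    next
      case 2 then show ?thesis using new by blast
    next
      case 3 then show ?thesis using new sym by blast
    next
      case 4 then show ?thesis using P(2) unfolding partial_iso_def by blast
    qed
    then show "a = a' \<longleftrightarrow> b = b'" "adj G a a' \<longleftrightarrow> adj H b b'"
      by blast+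
  qed
  then show ?thesis by blast
qed

section \<open>Back-and-forth arguments through dense sets\<close>

text \<open>The Rasiowa-Sikorski construction: list the dense sets and enter the \<open>n\<close>-th
  one at stage \<open>n + 1\<close>. It carries the bookkeeping for both universality and
  back-and-forth.\<close>

lemma chain_meeting_dense_sets:
  assumes "countable \<D>" and P: "P \<in> Q"
    and dense: "\<And>D p. D \<in> \<D> \<Longrightarrow> p \<in> Q \<Longrightarrow> \<exists>q\<in>Q. p \<subseteq> q \<and> q \<in> D"
  shows "\<exists>C :: nat \<Rightarrow> 'a set. C 0 = P \<and> mono C \<and> (\<forall>n. C n \<in> Q) \<and> (\<forall>D\<in>\<D>. \<exists>n. C n \<in> D)"
proof (cases "\<D> = {}")
  case True
  then show ?thesis
    using P by (intro exI[of _ "\<lambda>_. P"]) (auto simp: mono_def)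
next
  case False
  \<comment> \<open>An enumeration, possibly with repetitions, of a nonempty countable family; hence
    the separate case of an empty one.\<close>
  define d where "d = from_nat_into \<D>"
  have "\<exists>C. \<forall>n. (C n \<in> Q \<and> (n = 0 \<longrightarrow> C n = P)) \<and> (C n \<subseteq> C (Suc n) \<and> C (Suc n) \<in> d n)"
  proof (rule dependent_nat_choice)
    show "\<exists>p. p \<in> Q \<and> (0 = (0::nat) \<longrightarrow> p = P)"
      using P by blast
    fix p and n :: nat
    assume "p \<in> Q \<and> (n = 0 \<longrightarrow> p = P)"
    moreover have "d n \<in> \<D>"
      using False by (simp add: d_def from_nat_into)
    ultimately show "\<exists>q. (q \<in> Q \<and> (Suc n = 0 \<longrightarrow> q = P)) \<and> (p \<subseteq> q \<and> q \<in> d n)"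
      using dense by blast
  qed
  then obtain C where C: "C 0 = P" "\<And>n. C n \<in> Q" "\<And>n. C n \<subseteq> C (Suc n)" "\<And>n. C (Suc n) \<in> d n"
    by blast
  have "mono C"
    using C(3) by (simp add: mono_iff_le_Suc)
  moreover have "\<exists>n. C n \<in> D" if "D \<in> \<D>" for D
    using C(4) from_nat_into_surj[OF assms(1) that] unfolding d_def by metis
  ultimately show ?thesis
    using C(1,2) by blast
qed

text \<open>Going forth only: the finite partial isomorphisms with \<open>x\<close> in their domain
  are dense for each vertex \<open>x\<close> of \<open>G\<close>. The limit has full domain, and its
  range serves as \<open>W\<close>.\<close>

lemma extension_property_universal:
  assumes G: "is_ugraph G" "clique_free k G" "countable (verts G)"
    and H: "is_ugraph H" "extension_property k H" and k: "k \<ge> 2"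
  shows "\<exists>W\<subseteq>verts H. isomorphic G (induced H W)"
proof -
  define Q where "Q = {P. finite P \<and> partial_iso G H P}"
  define \<D> where "\<D> = (\<lambda>x. {P :: ('a \<times> 'b) set. x \<in> Domain P}) ` verts G"
  have cnt: "countable \<D>"
    using G(3) by (simp add: \<D>_def)
  have empty: "{} \<in> Q"
    by (simp add: Q_def partial_iso_def)
  have dense: "\<exists>q\<in>Q. p \<subseteq> q \<and> q \<in> D" if D: "D \<in> \<D>" and p: "p \<in> Q" for D p
  proof -
    obtain x where x: "x \<in> verts G" "D = {P. x \<in> Domain P}"
      using D by (auto simp: \<D>_def)
    obtain y where "partial_iso G H (insert (x, y) p)"
      using partial_iso_extend[OF G(1,2) H k _ _ x(1)] p by (auto simp: Q_def)
    then show ?thesis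
      using p x(2) by (intro bexI[of _ "insert (x, y) p"]) (auto simp: Q_def)
  qed
  obtain C :: "nat \<Rightarrow> ('a \<times> 'b) set"
    where C: "C 0 = {}" "mono C" "\<And>n. C n \<in> Q" "\<And>D. D \<in> \<D> \<Longrightarrow> \<exists>n. C n \<in> D"
    using chain_meeting_dense_sets[OF cnt empty dense] by auto
  have U: "partial_iso G H (\<Union>n. C n)"
    using C by (intro partial_iso_UN_chain) (auto simp: Q_def)
  have "Domain (\<Union>n. C n) = verts G"
  proof
    show "Domain (\<Union>n. C n) \<subseteq> verts G"
      using U unfolding partial_iso_def by blast
    show "verts G \<subseteq> Domain (\<Union>n. C n)"
      using C(4) unfolding \<D>_def by blast
  qed
  from partial_iso_graph_iso[OF U this]
  obtain f where "graph_iso f G (induced H (Range (\<Union>n. C n)))"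
    by (elim exE conjE)
  moreover have "Range (\<Union>n. C n) \<subseteq> verts H"
    using U unfolding partial_iso_def by blast
  ultimately show ?thesis
    unfolding isomorphic_def by blast
qed

text \<open>Dense sets for the vertices of \<open>H\<close> are added, so that the limit is also
  onto. The hypotheses are symmetric in \<open>G\<close> and \<open>H\<close>, which makes the forth
  step available in both directions.\<close>

lemma back_and_forth:
  assumes G: "is_ugraph G" "clique_free k G" "countable (verts G)" "extension_property k G"
    and H: "is_ugraph H" "clique_free k H" "countable (verts H)" "extension_property k H"
    and k: "k \<ge> 2" and P: "finite P" "partial_iso G H P"
  obtains g where "graph_iso g G H" "\<And>x y. (x, y) \<in> P \<Longrightarrow> g x = y"
proof -
  define Q where "Q = {P. finite P \<and> partial_iso G H P}"
  define \<D> where "\<D> = (\<lambda>x. {P :: ('a \<times> 'b) set. x \<in> Domain P}) ` verts G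
    \<union> (\<lambda>y. {P. y \<in> Range P}) ` verts H"
  have cnt: "countable \<D>"
    using G(3) H(3) by (simp add: \<D>_def)
  have PQ: "P \<in> Q"
    using P by (simp add: Q_def)
  have dense: "\<exists>q\<in>Q. p \<subseteq> q \<and> q \<in> D" if D: "D \<in> \<D>" and p: "p \<in> Q" for D p
  proof -
    consider x where "x \<in> verts G" "D = {P. x \<in> Domain P}"
      | y where "y \<in> verts H" "D = {P. y \<in> Range P}"
      using D unfolding \<D>_def by blast
    then show ?thesis
    proof cases
      case (1 x)
      obtain y where "partial_iso G H (insert (x, y) p)"
        using partial_iso_extend[OF G(1,2) H(1,4) k _ _ 1(1)] p by (auto simp: Q_def)
      then show ?thesis
        using p 1(2) by (intro bexI[of _ "insert (x, y) p"]) (auto simp: Q_def)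
    next
      case (2 y)
      \<comment> \<open>The back step is the forth step from \<open>H\<close> to \<open>G\<close>,
        applied to the converse.\<close>
      have "finite (p\<inverse>)" "partial_iso H G (p\<inverse>)"
        using p by (simp_all add: Q_def partial_iso_converse)
      then obtain x where "partial_iso H G (insert (y, x) (p\<inverse>))"
        using partial_iso_extend[OF H(1,2) G(1,4) k _ _ 2(1)] by blast
      moreover have "insert (y, x) (p\<inverse>) = (insert (x, y) p)\<inverse>"
        by auto
      ultimately have "partial_iso G H (insert (x, y) p)"
        by (simp only: partial_iso_converse)
      then show ?thesis
        using p 2(2) by (intro bexI[of _ "insert (x, y) p"]) (auto simp: Q_def)
    qed
  qed
  obtain C :: "nat \<Rightarrow> ('a \<times> 'b) set"
    where C: "C 0 = P" "mono C" "\<And>n. C n \<in> Q" "\<And>D. D \<in> \<D> \<Longrightarrow> \<exists>n. C n \<in> D"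
    using chain_meeting_dense_sets[OF cnt PQ dense] by auto
  have U: "partial_iso G H (\<Union>n. C n)"
    using C by (intro partial_iso_UN_chain) (auto simp: Q_def)
  have dom: "Domain (\<Union>n. C n) = verts G"
  proof
    show "Domain (\<Union>n. C n) \<subseteq> verts G"
      using U unfolding partial_iso_def by blast
    show "verts G \<subseteq> Domain (\<Union>n. C n)"
      using C(4) unfolding \<D>_def by blast
  qed
  have ran: "Range (\<Union>n. C n) = verts H"
  proof
    show "Range (\<Union>n. C n) \<subseteq> verts H"
      using U unfolding partial_iso_def by blast
    show "verts H \<subseteq> Range (\<Union>n. C n)"
      using C(4) unfolding \<D>_def by blast
  qed
  obtain g where g: "graph_iso g G (induced H (verts H))" "\<And>x y. (x, y) \<in> (\<Union>n. C n) \<Longrightarrow> g x = y"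
    using partial_iso_graph_iso[OF U dom] unfolding ran by (elim exE conjE) metis
  have "graph_iso g G H"
    using g(1) by (auto simp: graph_iso_def induced_def bij_betw_def)
  moreover have "g x = y" if "(x, y) \<in> P" for x y
    using g(2) that C(1) by blast
  ultimately show thesis
    using that by blast
qed

text \<open>The graph of an isomorphism between finite induced subgraphs is a finite partial
  isomorphism of \<open>G\<close> with itself, from which back-and-forth can start.\<close>

lemma extension_property_ultrahomogeneous:
  assumes G: "is_ugraph G" "clique_free k G" "countable (verts G)" "extension_property k G"
    and k: "k \<ge> 2"
  shows "ultrahomogeneous G"
  unfolding ultrahomogeneous_def
proof (intro allI impI)
  fix A B f
  assume A: "finite A" "A \<subseteq> verts G" and B: "B \<subseteq> verts G"
    and f: "graph_iso f (induced G A) (induced G B)"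
  have verts: "verts (induced G A) = A" "verts (induced G B) = B"
    using A B by (auto simp: induced_def)
  have bij: "bij_betw f A B"
    and adj: "\<And>x y. x \<in> A \<Longrightarrow> y \<in> A \<Longrightarrow> adj (induced G A) x y \<longleftrightarrow> adj (induced G B) (f x) (f y)"
    using f by (auto simp: graph_iso_def verts)
  have fB: "f x \<in> B" if "x \<in> A" for x
    using bij that by (auto simp: bij_betw_def)
  have "partial_iso G G ((\<lambda>x. (x, f x)) ` A)"
    unfolding partial_iso_def
  proof (intro conjI allI impI)
    show "(\<lambda>x. (x, f x)) ` A \<subseteq> verts G \<times> verts G"
      using A B fB by auto
    fix a b a' b' assume "(a, b) \<in> (\<lambda>x. (x, f x)) ` A" "(a', b') \<in> (\<lambda>x. (x, f x)) ` A"
    then have ab: "a \<in> A" "b = f a" "a' \<in> A" "b' = f a'"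
      by auto
    show "a = a' \<longleftrightarrow> b = b'"
      using bij ab by (auto simp: bij_betw_def inj_on_def)
    show "adj G a a' \<longleftrightarrow> adj G b b'"
      using adj[OF ab(1,3)] ab fB by (simp add: induced_def)
  qed
  with finite_imageI[OF A(1)] obtain g
    where g: "graph_iso g G G" "\<And>x y. (x, y) \<in> (\<lambda>x. (x, f x)) ` A \<Longrightarrow> g x = y"
    by (rule back_and_forth[OF G G k]) blast
  then show "\<exists>g. graph_iso g G G \<and> (\<forall>x\<in>A. g x = f x)"
    by blast
qed

section \<open>Hereditarily finite sets\<close>

lemma finite_hset_obtain:
  assumes "finite A"
  obtains S where "\<And>X. X \<epsilon> S \<longleftrightarrow> X \<in> A"
  using hset_of_finite_set[OF assms] by blast

lemma wf_hmem: "wf {(X, S). X \<epsilon> S}"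
proof (rule wfUNIVI)
  fix P S assume "\<forall>S. (\<forall>X. (X, S) \<in> {(X, S). X \<epsilon> S} \<longrightarrow> P X) \<longrightarrow> P S"
  then show "P S"
    by (rule_tac hset_mem_induct) simp
qed

lemma hmem_irrefl: "\<not> X \<epsilon> X"
  using wf_irrefl[OF wf_hmem] by auto

text \<open>Foundation directly yields minimal elements. For maximal ones, membership is acyclic,
  and an acyclic relation on a finite set has a well-founded converse.\<close>

lemma hmem_maximal:
  assumes "finite K" "K \<noteq> {}"
  obtains m where "m \<in> K" "\<And>x. x \<in> K \<Longrightarrow> \<not> m \<epsilon> x"
proof -
  define r where "r = {(X, S). X \<epsilon> S}\<inverse> \<inter> K \<times> K"
  have "acyclic r"
    unfolding r_def using wf_acyclic[OF wf_hmem] acyclic_subset by (metis Int_lower1 acyclic_converse)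
  then have "wf r"
    using assms(1) by (intro finite_acyclic_wf) (simp_all add: r_def)
  then obtain m where "m \<in> K" "\<And>y. (y, m) \<in> r \<Longrightarrow> y \<notin> K"
    using assms(2) wfE_min by (metis ex_in_conv)
  then have "\<not> m \<epsilon> x" if "x \<in> K" for x
    using that unfolding r_def by blast
  with \<open>m \<in> K\<close> show thesis
    by (rule that)
qed

lemma infinite_hset_singletons:
  assumes "finite A"
  shows "infinite {w. \<exists>y. y \<notin> A \<and> (\<forall>X. X \<epsilon> w \<longleftrightarrow> X = y)}"
proof -
  have "\<exists>S. \<forall>X. X \<epsilon> S \<longleftrightarrow> X = y" for y
    by (rule finite_hset_obtain[of "{y}"]) auto
  then obtain s where s: "\<And>y X. X \<epsilon> s y \<longleftrightarrow> X = y"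
    by metis
  have inj: "inj s"
    using s by (metis injI)
  \<comment> \<open>Otherwise there would be a universal set, which would be an element of
    itself.\<close>
  have "infinite (UNIV :: hset set)"
  proof
    assume "finite (UNIV :: hset set)"
    then obtain S where "\<And>X. X \<epsilon> S"
      using finite_hset_obtain by (metis UNIV_I)
    then show False
      using hmem_irrefl by blast
  qed
  then have "infinite (s ` (- A))"
    using assms inj
    by (metis Compl_eq_Diff_UNIV Diff_infinite_finite finite_imageD inj_on_subset subset_UNIV)
  moreover have "s ` (- A) \<subseteq> {w. \<exists>y. y \<notin> A \<and> (\<forall>X. X \<epsilon> w \<longleftrightarrow> X = y)}"
    using s by auto
  ultimately show ?thesis
    using finite_subset by blast
qed

lemma hset_fresh_singleton:
  assumes "finite A" "finite F"
  obtains w y where "w \<notin> F" "y \<notin> A" "\<And>X. X \<epsilon> w \<longleftrightarrow> X = y"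
  using infinite_hset_singletons[OF assms(1)] assms(2) finite_subset
  by (smt (verit, best) mem_Collect_eq subsetI)

section \<open>The graphs \<open>\<R>\<^sub>k\<close>\<close>

lemma verts_R_graph:
  "verts (R_graph k) = {S. \<not> (\<exists>T. hsubset T S \<and> complete_hset T \<and> hcard T = k - 1)}"
  by (simp add: R_graph_def Let_def)

lemma adj_R_graph:
  "adj (R_graph k) S S' \<longleftrightarrow>
     S \<in> verts (R_graph k) \<and> S' \<in> verts (R_graph k) \<and> S \<noteq> S' \<and> (S \<epsilon> S' \<or> S' \<epsilon> S)"
  by (simp add: R_graph_def Let_def)

text \<open>Trades the subset \<open>T\<close> inside the model for an ordinary set
  \<open>K\<close>; each finite set of elements is realised by some \<open>hset\<close>.\<close>

lemma in_verts_R_graph_iff: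
  "S \<in> verts (R_graph k) \<longleftrightarrow>
     \<not> (\<exists>K\<subseteq>{X. X \<epsilon> S}. (\<forall>X\<in>K. \<forall>Y\<in>K. X \<noteq> Y \<longrightarrow> X \<epsilon> Y \<or> Y \<epsilon> X) \<and> card K = k - 1)"
proof -
  have "(\<exists>T. hsubset T S \<and> complete_hset T \<and> hcard T = k - 1) \<longleftrightarrow>
     (\<exists>K\<subseteq>{X. X \<epsilon> S}. (\<forall>X\<in>K. \<forall>Y\<in>K. X \<noteq> Y \<longrightarrow> X \<epsilon> Y \<or> Y \<epsilon> X) \<and> card K = k - 1)"
    (is "?L \<longleftrightarrow> ?R")
  proof
    assume ?L
    then obtain T where "hsubset T S" "complete_hset T" "hcard T = k - 1" by blast
    then show ?R
      by (intro exI[of _ "{X. X \<epsilon> T}"]) (auto simp: hsubset_def complete_hset_def hcard_def)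
  next
    assume ?R
    then obtain K where K: "K \<subseteq> {X. X \<epsilon> S}" "\<forall>X\<in>K. \<forall>Y\<in>K. X \<noteq> Y \<longrightarrow> X \<epsilon> Y \<or> Y \<epsilon> X" "card K = k - 1"
      by blast
    have "finite K"
      using K(1) hset_finite finite_subset by blast
    then obtain T where "\<And>X. X \<epsilon> T \<longleftrightarrow> X \<in> K"
      using finite_hset_obtain by blast
    with K show ?L
      by (intro exI[of _ T]) (auto simp: hsubset_def complete_hset_def hcard_def)
  qed
  then show ?thesis by (simp only: verts_R_graph mem_Collect_eq)
qed

lemma clique_free_R_graph:
  assumes "k \<ge> 1"
  shows "clique_free k (R_graph k)"
  unfolding clique_free_def
proof
  assume "\<exists>K. finite K \<and> card K = k \<and> clique (R_graph k) K"
  then obtain K where K: "finite K" "card K = k" "clique (R_graph k) K" by blast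
  then have "K \<noteq> {}" using assms by auto
  then obtain m where m: "m \<in> K" "\<And>x. x \<in> K \<Longrightarrow> \<not> m \<epsilon> x"
    using hmem_maximal[OF K(1)] by blast
  have adj: "x \<epsilon> y \<or> y \<epsilon> x" if "x \<in> K" "y \<in> K" "x \<noteq> y" for x y
    using K(3) that by (auto simp: clique_def adj_R_graph)
  \<comment> \<open>Each other member of \<open>K\<close> is comparable with \<open>m\<close>, and
    maximality of \<open>m\<close> leaves only one direction of membership.\<close>
  have "K - {m} \<subseteq> {X. X \<epsilon> m}"
    using adj m by blast
  moreover have "card (K - {m}) = k - 1"
    using K m by simp
  ultimately have "m \<notin> verts (R_graph k)"
    unfolding in_verts_R_graph_iff using adj by blast
  then show False
    using K(3) m(1) by (auto simp: clique_def)
qed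

lemma extension_property_R_graph:
  assumes "k \<ge> 3"
  shows "extension_property k (R_graph k)"
  unfolding extension_property_def
proof (intro allI impI)
  fix A B
  assume fin: "finite A" "finite B" and A: "A \<subseteq> verts (R_graph k)" and B: "B \<subseteq> verts (R_graph k)"
    and disj: "A \<inter> B = {}" and nocl: "\<not> (\<exists>K\<subseteq>A. clique (R_graph k) K \<and> card K = k - 1)"
  define el where "el M = (\<Union>S\<in>M. {X. X \<epsilon> S})" for M
  have fin_el: "finite (el M)" if "finite M" for M
    using that hset_finite by (simp add: el_def)
  \<comment> \<open>What \<open>w\<close> must avoid, for \<open>z\<close> with elements
    \<open>A\<close> and \<open>w\<close>: \<open>B\<close>, so that \<open>w\<close> is not itself
    a neighbour of \<open>z\<close> in \<open>B\<close>; \<open>el (A \<union> B)\<close>, so that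
    \<open>z\<close> is not in \<open>A\<close> or \<open>B\<close> and \<open>w\<close> is in no
    member of \<open>A\<close>; \<open>el (el B)\<close>, so that \<open>z\<close> is in no member
    of \<open>B\<close>. Its element \<open>y\<close> avoids \<open>A\<close>, so no member of
    \<open>A\<close> lies in \<open>w\<close>.\<close>
  have "finite (B \<union> el (A \<union> B) \<union> el (el B))"
    using fin fin_el by simp
  then obtain w y where w: "w \<notin> B \<union> el (A \<union> B) \<union> el (el B)" and y: "y \<notin> A"
    and wy: "\<And>X. X \<epsilon> w \<longleftrightarrow> X = y"
    using hset_fresh_singleton[OF fin(1)] by metis
  obtain z where z: "\<And>X. X \<epsilon> z \<longleftrightarrow> X \<in> insert w A"
    using finite_hset_obtain[of "insert w A"] fin(1) by auto
  have zA: "z \<notin> A" and zB: "z \<notin> B" and zelB: "\<And>b. b \<in> B \<Longrightarrow> \<not> z \<epsilon> b"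
    using w z[of w] by (auto simp: el_def)
  have "z \<in> verts (R_graph k)"
    unfolding in_verts_R_graph_iff
  proof
    assume "\<exists>K\<subseteq>{X. X \<epsilon> z}. (\<forall>X\<in>K. \<forall>Y\<in>K. X \<noteq> Y \<longrightarrow> X \<epsilon> Y \<or> Y \<epsilon> X) \<and> card K = k - 1"
    then obtain K where K: "K \<subseteq> insert w A" "\<forall>X\<in>K. \<forall>Y\<in>K. X \<noteq> Y \<longrightarrow> X \<epsilon> Y \<or> Y \<epsilon> X"
      "card K = k - 1"
      unfolding z Collect_mem_eq by blast
    have "w \<notin> K"
    proof
      assume wK: "w \<in> K"
      \<comment> \<open>Here \<open>k \<ge> 3\<close> enters: \<open>K\<close> has
        \<open>k - 1 \<ge> 2\<close> elements, so \<open>w\<close> would have to be comparable with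
        some member of \<open>A\<close>.\<close>
      have "card (K - {w}) \<noteq> 0"
        using wK K(3) assms by simp
      then obtain a where a: "a \<in> K" "a \<noteq> w"
        by (metis Diff_iff card_gt_0_iff ex_in_conv gr0I singleton_iff)
      then have "a \<in> A" "a \<epsilon> w \<or> w \<epsilon> a"
        using K wK by auto
      then show False
        using w y wy by (auto simp: el_def)
    qed
    then have "K \<subseteq> A" using K(1) by blast
    moreover have "clique (R_graph k) K"
      using \<open>K \<subseteq> A\<close> A K(2) unfolding clique_def adj_R_graph by blast
    ultimately show False
      using nocl K(3) by blast
  qed
  moreover have "\<forall>a\<in>A. adj (R_graph k) z a"
    using \<open>z \<in> _\<close> A zA z by (auto simp: adj_R_graph)
  moreover have "\<forall>b\<in>B. \<not> adj (R_graph k) z b"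
    using zelB z w disj by (auto simp: adj_R_graph)
  ultimately show "\<exists>z\<in>verts (R_graph k). z \<notin> B \<and> (\<forall>a\<in>A. adj (R_graph k) z a) \<and>
      (\<forall>b\<in>B. \<not> adj (R_graph k) z b)"
    using zB by blast
qed

theorem theorem2p2:
  fixes k :: nat
  assumes "k \<ge> 3"
  shows "\<not> contains_subgraph (R_graph k) (complete_graph k) \<and>
         generic_for (countable_K_free k :: 'b ugraph set) (R_graph k)"
proof -
  have k: "k \<ge> 2"
    using assms by simp
  have free: "clique_free k (R_graph k)"
    using clique_free_R_graph assms by simp
  note ext = extension_property_R_graph[OF assms]
  have "ultrahomogeneous (R_graph k)"
    \<comment> \<open>The open premise is countability of the vertex set; it holds because
      Ackermann's coding makes \<open>hset\<close> a countable type.\<close>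
    using is_ugraph_R_graph free _ ext k by (rule extension_property_ultrahomogeneous) simp
  moreover have "\<exists>W\<subseteq>verts (R_graph k). isomorphic G (induced (R_graph k) W)"
    if "G \<in> countable_K_free k" for G :: "'b ugraph"
    using that is_ugraph_R_graph ext k
    by (intro extension_property_universal) (auto simp: countable_K_free_def contains_complete_graph_iff)
  ultimately show ?thesis
    using free by (simp add: generic_for_def contains_complete_graph_iff is_ugraph_R_graph)
qed

end
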